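(* Let $X$ be a completely regular topological space. Then $\mathbb{H}_{cm}(X)$ is the Dedekind order completion of $C(X)$, that is, $C(X)^{\#}=\mathbb{H}_{cm}(X)\subseteq\mathbb{H}_{ft}(X)$.
   Context: Let $\overline{\mathbb{R}}=\mathbb{R}\cup\{\pm\infty\}$ and let $\mathbb{I}\overline{\mathbb{R}}=\{[\underline a,\overline a]:\underline a,\overline a\in\overline{\mathbb{R}},\ \underline a\le\overline a\}$ be the set of closed intervals $[\underline a,\overline a]=\{z\in\overline{\mathbb R}:\underline a\le z\le\overline a\}$, partially ordered by $[\underline a,\overline a]\le[\underline b,\overline b]\iff \underline a\le\underline b$ and $\overline a\le\overline b$. A point $x\in\overline{\mathbb{R}}$ is identified with $[x,x]$. For a topological space $X$ let $\mathbb{A}(X)$ be the set of all functions $f:X\to\mathbb{I}\overline{\mathbb{R}}$, ordered pointwise: $f\le g\iff f(x)\le g(x)$ for all $x\in X$. Let $\mathcal{A}(X)\subset\mathbb{A}(X)$ be the set of functions $X\to\overline{\mathbb{R}}$. With $\mathcal{V}_x$ the set of neighborhoods of $x$, define for $f\in\mathbb{A}(X)$ the functions $I(f),S(f)\in\mathcal{A}(X)$ and $F(f)\in\mathbb{A}(X)$ by $I(f)(x)=\sup_{V\in\mathcal{V}_x}\inf\{z\in f(y):y\in V\}$, $S(f)(x)=\inf_{V\in\mathcal{V}_x}\sup\{z\in f(y):y\in V\}$, $F(f)(x)=[I(f)(x),S(f)(x)]$. A function $f\in\mathbb{A}(X)$ is Hausdorff continuous (H-continuous) if for every $g\in\mathbb{A}(X)$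 with $g(x)\subseteq f(x)$ for all $x\in X$ one has $F(g)(x)=f(x)$ for all $x\in X$. $\mathbb{H}(X)$ is the set of all H-continuous functions on $X$, and $\mathbb{H}_{ft}(X)=\{f\in\mathbb{H}(X): f(x)\subseteq\mathbb{R}\text{ for all }x\in X\}$. $C(X)$ is the set of all continuous functions $X\to\mathbb{R}$, and $\mathbb{H}_{cm}(X)=\{f\in\mathbb{H}_{ft}(X):\exists\varphi,\psi\in C(X):\ \varphi\le f\le\psi\}$ is the set of H-continuous functions with a continuous minorant and a continuous majorant; $C(X)\subseteq\mathbb{H}_{cm}(X)$. All these sets carry the order induced from $\mathbb{A}(X)$. A partially ordered set $P$ is Dedekind order complete if every nonempty subset of $P$ bounded from above in $P$ has a supremum in $P$ and every nonempty subset of $P$ bounded from below in $P$ has an infimum in $P$. For a subset $P$ of a partially ordered set $Q$ (with the induced order), $Q$ is the Dedekind order completion $P^{\#}$ of $P$ if $Q$ is Dedekind order complete and every element of $Q$ is both the supremum in $Q$ of some subset of $P$ and the infimum in $Q$ of some subset of $P$. Completely regular means: for every $x\in X$ and every neighborhood $V$ of $x$ there is a continuous $\phi:X\to[0,1]$ with $\phi(x)=1$ and $\phi(y)=0$ for $y\notin V$. *)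

theory Defs
  imports "HOL-Analysis.Analysis" "HOL-Library.Interval" "HOL-Algebra.Order"
begin

section \<open>Interval-valued functions on a topological space\<close>

text \<open>
  Functions on the space \<open>X\<close> are represented by extensional functions on \<open>topspace X\<close>,
  so that equality of functions is equality on the points of \<open>X\<close>.
\<close>

definition interval_funs :: "'a topology \<Rightarrow> ('a \<Rightarrow> ereal interval) set" where
  "interval_funs X = topspace X \<rightarrow>\<^sub>E UNIV"

text \<open>
  The library's \<open>(\<le>)\<close> on \<^typ>\<open>ereal interval\<close> is inclusion; the order used here
  is the endpointwise one.
\<close>

definition interval_le :: "ereal interval \<Rightarrow> ereal interval \<Rightarrow> bool" where
  "interval_le a b \<longleftrightarrow> lower a \<le> lower b \<and> upper a \<le> upper b"

definition fun_le :: "'a topology \<Rightarrow> ('a \<Rightarrow> ereal interval) \<Rightarrow> ('a \<Rightarrow> ereal interval) \<Rightarrow> bool" where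
  "fun_le X f g \<longleftrightarrow> (\<forall>x\<in>topspace X. interval_le (f x) (g x))"

definition nbhds_of :: "'a topology \<Rightarrow> 'a \<Rightarrow> 'a set set" where
  "nbhds_of X x = {V. V \<subseteq> topspace X \<and> (\<exists>U. openin X U \<and> x \<in> U \<and> U \<subseteq> V)}"

definition lower_baire :: "'a topology \<Rightarrow> ('a \<Rightarrow> ereal interval) \<Rightarrow> 'a \<Rightarrow> ereal" where
  "lower_baire X f x = (SUP V\<in>nbhds_of X x. Inf (\<Union>y\<in>V. set_of (f y)))"

definition upper_baire :: "'a topology \<Rightarrow> ('a \<Rightarrow> ereal interval) \<Rightarrow> 'a \<Rightarrow> ereal" where
  "upper_baire X f x = (INF V\<in>nbhds_of X x. Sup (\<Union>y\<in>V. set_of (f y)))"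

definition graph_completion ::
    "'a topology \<Rightarrow> ('a \<Rightarrow> ereal interval) \<Rightarrow> 'a \<Rightarrow> ereal interval" where
  "graph_completion X f = (\<lambda>x\<in>topspace X. Interval (lower_baire X f x, upper_baire X f x))"

text \<open>
  \<^const>\<open>Interval\<close> is unspecified on pairs whose components are not in order; the following
  lemmas show that this case does not arise in \<^const>\<open>graph_completion\<close>.
\<close>

lemma mem_nbhd: "V \<in> nbhds_of X x \<Longrightarrow> x \<in> V"
  by (auto simp: nbhds_of_def)

lemma lower_baire_le: "lower_baire X f x \<le> lower (f x)"
  unfolding lower_baire_def
  by (rule SUP_least, rule Inf_lower) (auto dest: mem_nbhd simp: set_of_eq intro!: bexI[of _ x])

lemma upper_baire_ge: "upper (f x) \<le> upper_baire X f x"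
  unfolding upper_baire_def
  by (rule INF_greatest, rule Sup_upper) (auto dest: mem_nbhd simp: set_of_eq intro!: bexI[of _ x])

lemma lower_baire_le_upper_baire: "lower_baire X f x \<le> upper_baire X f x"
  using lower_baire_le lower_le_upper upper_baire_ge by (rule order_trans[OF order_trans])

lemma lower_graph_completion:
  "x \<in> topspace X \<Longrightarrow> lower (graph_completion X f x) = lower_baire X f x"
  by (simp add: graph_completion_def lower.rep_eq Interval_inverse lower_baire_le_upper_baire)

lemma upper_graph_completion:
  "x \<in> topspace X \<Longrightarrow> upper (graph_completion X f x) = upper_baire X f x"
  by (simp add: graph_completion_def upper.rep_eq Interval_inverse lower_baire_le_upper_baire)


section \<open>Hausdorff continuous functions\<close>

definition H_continuous :: "'a topology \<Rightarrow> ('a \<Rightarrow> ereal interval) \<Rightarrow> bool" where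
  "H_continuous X f \<longleftrightarrow> f \<in> interval_funs X \<and>
     (\<forall>g\<in>interval_funs X. (\<forall>x\<in>topspace X. set_of (g x) \<subseteq> set_of (f x)) \<longrightarrow>
        (\<forall>x\<in>topspace X. graph_completion X g x = f x))"

definition H_funs :: "'a topology \<Rightarrow> ('a \<Rightarrow> ereal interval) set" where
  "H_funs X = {f. H_continuous X f}"

definition H_ft :: "'a topology \<Rightarrow> ('a \<Rightarrow> ereal interval) set" where
  "H_ft X = {f \<in> H_funs X. \<forall>x\<in>topspace X. set_of (f x) \<subseteq> range ereal}"

text \<open>Points are identified with degenerate intervals.\<close>

definition embed_real :: "'a topology \<Rightarrow> ('a \<Rightarrow> real) \<Rightarrow> 'a \<Rightarrow> ereal interval" where
  "embed_real X \<phi> = (\<lambda>x\<in>topspace X. interval_of (ereal (\<phi> x)))"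

definition C_funs :: "'a topology \<Rightarrow> ('a \<Rightarrow> ereal interval) set" where
  "C_funs X = embed_real X ` {\<phi>. continuous_map X euclideanreal \<phi>}"

definition H_cm :: "'a topology \<Rightarrow> ('a \<Rightarrow> ereal interval) set" where
  "H_cm X = {f \<in> H_ft X. \<exists>\<phi>\<in>C_funs X. \<exists>\<psi>\<in>C_funs X. fun_le X \<phi> f \<and> fun_le X f \<psi>}"

definition fun_order :: "'a topology \<Rightarrow> ('a \<Rightarrow> ereal interval) set \<Rightarrow> ('a \<Rightarrow> ereal interval) gorder" where
  "fun_order X F = \<lparr>carrier = F, eq = (=), le = fun_le X\<rparr>"


section \<open>Dedekind order completion\<close>

definition dedekind_complete :: "('p, 'm) gorder_scheme \<Rightarrow> bool" where
  "dedekind_complete Q \<longleftrightarrow> partial_order Q \<and>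
     (\<forall>A. A \<subseteq> carrier Q \<and> A \<noteq> {} \<and> Upper Q A \<noteq> {} \<longrightarrow> (\<exists>s. least Q s (Upper Q A))) \<and>
     (\<forall>A. A \<subseteq> carrier Q \<and> A \<noteq> {} \<and> Lower Q A \<noteq> {} \<longrightarrow> (\<exists>i. greatest Q i (Lower Q A)))"

definition is_dedekind_completion :: "('p, 'm) gorder_scheme \<Rightarrow> 'p set \<Rightarrow> bool" where
  "is_dedekind_completion Q P \<longleftrightarrow> P \<subseteq> carrier Q \<and> dedekind_complete Q \<and>
     (\<forall>q\<in>carrier Q. (\<exists>A\<subseteq>P. least Q q (Upper Q A)) \<and> (\<exists>B\<subseteq>P. greatest Q q (Lower Q B)))"


section \<open>Complete regularity\<close>

text \<open>
  The library separates points from closed sets; this is the formulation with neighbourhoods.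
\<close>

lemma completely_regular_space_nbhds:
  "completely_regular_space X \<longleftrightarrow>
     (\<forall>x\<in>topspace X. \<forall>V\<in>nbhds_of X x. \<exists>\<phi>. continuous_map X (top_of_set {0..1::real}) \<phi> \<and>
        \<phi> x = 1 \<and> (\<forall>y\<in>topspace X - V. \<phi> y = 0))" (is "?L \<longleftrightarrow> ?R")
proof
  assume L: ?L
  show ?R
  proof (intro ballI)
    fix x V assume x: "x \<in> topspace X" and V: "V \<in> nbhds_of X x"
    then obtain U where U: "openin X U" "x \<in> U" "U \<subseteq> V"
      by (auto simp: nbhds_of_def)
    then have "closedin X (topspace X - U)" "x \<in> topspace X - (topspace X - U)"
      using x by auto
    then obtain f :: "'a \<Rightarrow> real" where f: "continuous_map X (top_of_set {0..1}) f" "f x = 0"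
        "f ` (topspace X - U) \<subseteq> {1}"
      using L unfolding completely_regular_space_def by blast
    have "continuous_map X (top_of_set {0..1}) (\<lambda>y. 1 - f y)"
      using f(1) by (auto simp: continuous_map_in_subtopology Pi_iff image_subset_iff
          intro!: continuous_intros)
    then show "\<exists>\<phi>. continuous_map X (top_of_set {0..1::real}) \<phi> \<and>
        \<phi> x = 1 \<and> (\<forall>y\<in>topspace X - V. \<phi> y = 0)"
      using f U(3) by (intro exI[of _ "\<lambda>y. 1 - f y"]) auto
  qed
next
  assume R: ?R
  show ?L
    unfolding completely_regular_space_def
  proof (intro allI impI)
    fix S x assume S: "closedin X S \<and> x \<in> topspace X - S"
    then have "topspace X - S \<in> nbhds_of X x"
      by (auto simp: nbhds_of_def intro!: exI[of _ "topspace X - S"])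
    with R S obtain \<phi> where \<phi>: "continuous_map X (top_of_set {0..1::real}) \<phi>" "\<phi> x = 1"
        "\<forall>y\<in>topspace X - (topspace X - S). \<phi> y = 0" by blast
    have "continuous_map X (top_of_set {0..1}) (\<lambda>y. 1 - \<phi> y)"
      using \<phi>(1) by (auto simp: continuous_map_in_subtopology Pi_iff image_subset_iff
          intro!: continuous_intros)
    moreover have "(\<lambda>y. 1 - \<phi> y) ` S \<subseteq> {1}"
      using \<phi>(3) S closedin_subset by fastforce
    ultimately show "\<exists>f::'a\<Rightarrow>real. continuous_map X (top_of_set {0..1}) f \<and> f x = 0 \<and> f ` S \<subseteq> {1}"
      using \<phi>(2) by (intro exI[of _ "\<lambda>y. 1 - \<phi> y"]) auto
  qed
qed

end

theory Submission
  imports Defs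
begin

text \<open>
  The proof rests on two semicontinuous envelopes. Write \<open>I h\<close> for the largest lower semicontinuous
  minorant of an extended real function \<open>h\<close> and \<open>S h\<close> for its smallest upper semicontinuous majorant.
  An interval function \<open>f = [l, u]\<close> is H-continuous exactly if \<open>l = I u\<close> and \<open>u = S l\<close>
  (\<open>H_continuous_iff\<close>), so either endpoint determines the other one monotonically, and comparing two
  H-continuous functions amounts to comparing their lower endpoints, or their upper endpoints
  (\<open>fun_le_if_lower_le\<close>, \<open>fun_le_if_upper_le\<close>).

  Order completeness comes from the envelopes. For a nonempty bounded subset \<open>A\<close> of \<open>H_cm X\<close>, the pointwise
  supremum \<open>h\<close> of the lower endpoints is lower semicontinuous, and \<open>S I S h = S h\<close>; hence
  \<open>[I S h, S h]\<close> is H-continuous, and it is the least upper bound of \<open>A\<close> (\<open>H_cm_has_sup\<close>). Infima are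
  suprema of sets of lower bounds.

  Complete regularity makes \<open>C(X)\<close> dense in \<open>H_cm X\<close>. A lower semicontinuous function with a
  continuous minorant is the pointwise supremum of its continuous minorants, because a bump function
  lifts the given minorant near any chosen point (\<open>continuous_minorant\<close>). Applied to the lower
  endpoint of an element of \<open>H_cm X\<close>, and dually to the upper endpoint, this presents that element as
  a supremum and as an infimum of continuous functions.
\<close>


section \<open>Semicontinuous envelopes\<close>

definition lsc_env :: "'a topology \<Rightarrow> ('a \<Rightarrow> ereal) \<Rightarrow> 'a \<Rightarrow> ereal" where
  "lsc_env X h x = (SUP V\<in>nbhds_of X x. INF y\<in>V. h y)"

definition usc_env :: "'a topology \<Rightarrow> ('a \<Rightarrow> ereal) \<Rightarrow> 'a \<Rightarrow> ereal" where
  "usc_env X h x = (INF V\<in>nbhds_of X x. SUP y\<in>V. h y)"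

lemma lsc_env_le: "lsc_env X h x \<le> h x"
  unfolding lsc_env_def by (intro SUP_least INF_lower) (rule mem_nbhd)

lemma lsc_env_mono:
  assumes "\<And>y. y \<in> topspace X \<Longrightarrow> h y \<le> k y"
  shows "lsc_env X h x \<le> lsc_env X k x"
  unfolding lsc_env_def
  by (intro SUP_subset_mono INF_superset_mono order_refl assms) (auto simp: nbhds_of_def)

lemma lsc_env_geI:
  assumes "openin X U" "x \<in> U" "\<And>y. y \<in> U \<Longrightarrow> r \<le> h y"
  shows "r \<le> lsc_env X h x"
proof -
  have "U \<in> nbhds_of X x"
    using assms(1,2) openin_subset by (fastforce simp: nbhds_of_def)
  moreover have "r \<le> (INF y\<in>U. h y)"
    using assms(3) by (intro INF_greatest)
  ultimately show ?thesis
    unfolding lsc_env_def by (rule SUP_upper2)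
qed

lemma less_lsc_envD:
  assumes "r < lsc_env X h x"
  shows "\<exists>U. openin X U \<and> x \<in> U \<and> (\<forall>y\<in>U. r < h y)"
proof -
  obtain V where V: "V \<in> nbhds_of X x" "r < (INF y\<in>V. h y)"
    using assms unfolding lsc_env_def less_SUP_iff by blast
  then obtain U where U: "openin X U" "x \<in> U" "U \<subseteq> V"
    unfolding nbhds_of_def by blast
  then show ?thesis
    using less_INF_D[OF V(2)] by blast
qed

lemma lsc_env_idem: "lsc_env X (lsc_env X h) x = lsc_env X h x"
proof (rule antisym[OF lsc_env_le], rule dense_le)
  fix r assume r: "r < lsc_env X h x"
  obtain U where U: "openin X U" "x \<in> U" "\<forall>y\<in>U. r < h y"
    using less_lsc_envD[OF r] by auto
  have "r \<le> lsc_env X h y" if "y \<in> U" for y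
    using U(3) by (intro lsc_env_geI[OF U(1) that]) (simp add: less_imp_le)
  then show "r \<le> lsc_env X (lsc_env X h) x"
    by (rule lsc_env_geI[OF U(1,2)])
qed

lemma usc_env_conv_lsc_env: "usc_env X h x = - lsc_env X (\<lambda>y. - h y) x"
  unfolding usc_env_def lsc_env_def ereal_INF_uminus_eq ereal_SUP_uminus_eq ereal_uminus_uminus ..

lemma usc_env_ge: "h x \<le> usc_env X h x"
  unfolding usc_env_def by (intro INF_greatest SUP_upper) (rule mem_nbhd)

lemma usc_env_mono:
  assumes "\<And>y. y \<in> topspace X \<Longrightarrow> h y \<le> k y"
  shows "usc_env X h x \<le> usc_env X k x"
  using assms by (simp add: usc_env_conv_lsc_env lsc_env_mono)

lemma usc_env_idem: "usc_env X (usc_env X h) x = usc_env X h x"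
  by (simp add: usc_env_conv_lsc_env[abs_def] lsc_env_idem)

lemma usc_env_lessD:
  assumes "usc_env X h x < r"
  shows "\<exists>U. openin X U \<and> x \<in> U \<and> (\<forall>y\<in>U. h y < r)"
proof -
  have "- r < lsc_env X (\<lambda>y. - h y) x"
    using assms by (simp add: usc_env_conv_lsc_env ereal_uminus_less_reorder)
  from less_lsc_envD[OF this] show ?thesis
    by simp
qed

lemma lsc_env_continuous:
  assumes "continuous_map X euclideanreal \<phi>" "x \<in> topspace X"
  shows "lsc_env X (\<lambda>y. ereal (\<phi> y)) x = ereal (\<phi> x)"
proof (rule antisym[OF lsc_env_le], rule ereal_le_epsilon2)
  fix e :: real assume e: "0 < e"
  let ?U = "{y \<in> topspace X. \<phi> y \<in> {\<phi> x - e<..}}"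
  have "openin X ?U"
    using assms(1) by (rule openin_continuous_map_preimage) simp
  then have "ereal (\<phi> x - e) \<le> lsc_env X (\<lambda>y. ereal (\<phi> y)) x"
    using e assms(2) by (intro lsc_env_geI[of X ?U]) auto
  then show "ereal (\<phi> x) \<le> lsc_env X (\<lambda>y. ereal (\<phi> y)) x + ereal e"
    by (cases "lsc_env X (\<lambda>y. ereal (\<phi> y)) x") auto
qed

lemma usc_env_continuous:
  assumes "continuous_map X euclideanreal \<phi>" "x \<in> topspace X"
  shows "usc_env X (\<lambda>y. ereal (\<phi> y)) x = ereal (\<phi> x)"
  using lsc_env_continuous[of X "\<lambda>y. - \<phi> y" x] assms
  by (simp add: usc_env_conv_lsc_env continuous_map_minus)


section \<open>Hausdorff continuous functions through their endpoints\<close>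

lemma lower_baire_conv_lsc_env: "lower_baire X f x = lsc_env X (\<lambda>y. lower (f y)) x"
proof -
  have "Inf (\<Union>y\<in>V. set_of (f y)) = (INF y\<in>V. lower (f y))" for V
  proof (rule antisym)
    show "Inf (\<Union>y\<in>V. set_of (f y)) \<le> (INF y\<in>V. lower (f y))"
      by (rule INF_greatest, rule Inf_lower) (auto simp: set_of_eq)
    show "(INF y\<in>V. lower (f y)) \<le> Inf (\<Union>y\<in>V. set_of (f y))"
      by (rule Inf_greatest) (auto simp: set_of_eq intro: INF_lower2)
  qed
  then show ?thesis
    by (simp add: lower_baire_def lsc_env_def)
qed

lemma upper_baire_conv_usc_env: "upper_baire X f x = usc_env X (\<lambda>y. upper (f y)) x"
proof -
  have "Sup (\<Union>y\<in>V. set_of (f y)) = (SUP y\<in>V. upper (f y))" for V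
    using SUP_UNION[of "\<lambda>z. z" "\<lambda>y. set_of (f y)" V] by (simp add: set_of_eq)
  then show ?thesis
    by (simp add: upper_baire_def usc_env_def)
qed

lemma graph_completion_eq_iff:
  assumes "x \<in> topspace X"
  shows "graph_completion X g x = i \<longleftrightarrow>
    lsc_env X (\<lambda>y. lower (g y)) x = lower i \<and> usc_env X (\<lambda>y. upper (g y)) x = upper i"
  using assms by (auto simp: interval_eq_iff lower_graph_completion upper_graph_completion
      lower_baire_conv_lsc_env upper_baire_conv_usc_env)

text \<open>
  The two degenerate selections, lower endpoint and upper endpoint, are extremal among the
  functions \<open>g\<close> inside \<open>f\<close>: every other \<open>g\<close> is squeezed between them, and the envelopes are
  idempotent.
\<close>

lemma H_continuous_iff:
  assumes "f \<in> interval_funs X"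
  shows "H_continuous X f \<longleftrightarrow> (\<forall>x\<in>topspace X. lsc_env X (\<lambda>y. upper (f y)) x = lower (f x) \<and>
    usc_env X (\<lambda>y. lower (f y)) x = upper (f x))" (is "_ \<longleftrightarrow> ?R")
proof
  assume H: "H_continuous X f"
  have GC: "\<forall>x\<in>topspace X. graph_completion X g x = f x"
    if "g \<in> interval_funs X" "\<And>x. x \<in> topspace X \<Longrightarrow> set_of (g x) \<subseteq> set_of (f x)" for g
    using H that unfolding H_continuous_def by blast
  show ?R
  proof
    fix x assume x: "x \<in> topspace X"
    \<comment> \<open>the selections that recover \<open>upper f\<close> from \<open>lower f\<close> and conversely\<close>
    let ?gl = "\<lambda>x\<in>topspace X. interval_of (lower (f x))"
    let ?gu = "\<lambda>x\<in>topspace X. interval_of (upper (f x))"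
    have "graph_completion X ?gl x = f x" "graph_completion X ?gu x = f x"
      using x by (auto intro!: GC[rule_format] simp: interval_funs_def set_of_eq)
    then have "usc_env X (\<lambda>y. upper (?gl y)) x = upper (f x)"
      "lsc_env X (\<lambda>y. lower (?gu y)) x = lower (f x)"
      using x by (simp_all add: graph_completion_eq_iff)
    moreover have "usc_env X (\<lambda>y. upper (?gl y)) x = usc_env X (\<lambda>y. lower (f y)) x"
      "lsc_env X (\<lambda>y. lower (?gu y)) x = lsc_env X (\<lambda>y. upper (f y)) x"
      by (auto intro!: antisym usc_env_mono lsc_env_mono)
    ultimately show "lsc_env X (\<lambda>y. upper (f y)) x = lower (f x) \<and>
        usc_env X (\<lambda>y. lower (f y)) x = upper (f x)"
      by simp
  qed
next
  assume R: ?R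
  have "graph_completion X g x = f x"
    if g: "\<forall>x\<in>topspace X. set_of (g x) \<subseteq> set_of (f x)" and x: "x \<in> topspace X" for g x
  proof -
    have sub: "lower (f y) \<le> lower (g y)" "upper (g y) \<le> upper (f y)"
      "lower (g y) \<le> upper (f y)" "lower (f y) \<le> upper (g y)" if "y \<in> topspace X" for y
    proof -
      show *: "lower (f y) \<le> lower (g y)" "upper (g y) \<le> upper (f y)"
        using g[rule_format, OF that] by (simp_all add: set_of_eq)
      show "lower (g y) \<le> upper (f y)" "lower (f y) \<le> upper (g y)"
        using * lower_le_upper[of "g y"] by (meson order_trans)+
    qed
    have "lower (f x) = lsc_env X (lsc_env X (\<lambda>y. upper (f y))) x"
      using R x by (simp add: lsc_env_idem)
    also have "\<dots> \<le> lsc_env X (\<lambda>y. lower (g y)) x"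
      using R sub by (intro lsc_env_mono) simp
    finally have 1: "lower (f x) \<le> lsc_env X (\<lambda>y. lower (g y)) x" .
    have 2: "lsc_env X (\<lambda>y. lower (g y)) x \<le> lower (f x)"
      using lsc_env_mono[of X "\<lambda>y. lower (g y)" "\<lambda>y. upper (f y)" x] R x sub by simp
    have "usc_env X (\<lambda>y. upper (g y)) x \<le> usc_env X (usc_env X (\<lambda>y. lower (f y))) x"
      using R sub by (intro usc_env_mono) simp
    also have "\<dots> = upper (f x)"
      using R x by (simp add: usc_env_idem)
    finally have 3: "usc_env X (\<lambda>y. upper (g y)) x \<le> upper (f x)" .
    have 4: "upper (f x) \<le> usc_env X (\<lambda>y. upper (g y)) x"
      using usc_env_mono[of X "\<lambda>y. lower (f y)" "\<lambda>y. upper (g y)" x] R x sub by simp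
    show ?thesis
      using 1 2 3 4 x by (simp add: graph_completion_eq_iff antisym)
  qed
  then show "H_continuous X f"
    using assms by (simp add: H_continuous_def)
qed

lemma H_continuousD:
  assumes "H_continuous X f" "x \<in> topspace X"
  shows "lsc_env X (\<lambda>y. upper (f y)) x = lower (f x)" "usc_env X (\<lambda>y. lower (f y)) x = upper (f x)"
  using assms H_continuous_iff[of f X] by (auto simp: H_continuous_def)

lemma fun_le_if_lower_le:
  assumes "H_continuous X f" "H_continuous X g"
    and "\<And>x. x \<in> topspace X \<Longrightarrow> lower (f x) \<le> lower (g x)"
  shows "fun_le X f g"
  unfolding fun_le_def interval_le_def
  using assms usc_env_mono[of X "\<lambda>y. lower (f y)" "\<lambda>y. lower (g y)"]
  by (metis H_continuousD(2))

lemma fun_le_if_upper_le: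
  assumes "H_continuous X f" "H_continuous X g"
    and "\<And>x. x \<in> topspace X \<Longrightarrow> upper (f x) \<le> upper (g x)"
  shows "fun_le X f g"
  unfolding fun_le_def interval_le_def
  using assms lsc_env_mono[of X "\<lambda>y. upper (f y)" "\<lambda>y. upper (g y)"]
  by (metis H_continuousD(1))

lemma lsc_env_lower:
  assumes "H_continuous X f" "x \<in> topspace X"
  shows "lsc_env X (\<lambda>y. lower (f y)) x = lower (f x)"
proof -
  have "lsc_env X (\<lambda>y. lower (f y)) x = lsc_env X (lsc_env X (\<lambda>y. upper (f y))) x"
    using assms(1) by (intro antisym lsc_env_mono) (simp_all add: H_continuousD)
  then show ?thesis
    using assms by (simp add: lsc_env_idem H_continuousD)
qed

lemma usc_env_upper:
  assumes "H_continuous X f" "x \<in> topspace X"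
  shows "usc_env X (\<lambda>y. upper (f y)) x = upper (f x)"
proof -
  have "usc_env X (\<lambda>y. upper (f y)) x = usc_env X (usc_env X (\<lambda>y. lower (f y))) x"
    using assms(1) by (intro antisym usc_env_mono) (simp_all add: H_continuousD)
  then show ?thesis
    using assms by (simp add: usc_env_idem H_continuousD)
qed


section \<open>Continuous functions and continuous bounds\<close>

lemma fun_le_refl: "fun_le X f f"
  by (simp add: fun_le_def interval_le_def)

lemma fun_le_trans: "fun_le X f g \<Longrightarrow> fun_le X g h \<Longrightarrow> fun_le X f h"
  unfolding fun_le_def interval_le_def by (meson order_trans)

lemma fun_le_antisym:
  assumes "f \<in> interval_funs X" "g \<in> interval_funs X" "fun_le X f g" "fun_le X g f"
  shows "f = g"
  using assms unfolding interval_funs_def fun_le_def interval_le_def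
  by (intro PiE_ext[of f "topspace X" _ g]) (auto simp: interval_eq_iff intro: antisym)

lemma fun_le_embed_iff:
  "fun_le X (embed_real X \<phi>) f \<longleftrightarrow> (\<forall>x\<in>topspace X. ereal (\<phi> x) \<le> lower (f x))"
  by (auto simp: fun_le_def interval_le_def embed_real_def intro: order_trans[OF _ lower_le_upper])

lemma embed_fun_le_iff:
  "fun_le X f (embed_real X \<phi>) \<longleftrightarrow> (\<forall>x\<in>topspace X. upper (f x) \<le> ereal (\<phi> x))"
  by (auto simp: fun_le_def interval_le_def embed_real_def intro: order_trans[OF lower_le_upper])

text \<open>Finiteness of the values follows from the continuous bounds.\<close>

lemma H_cm_iff:
  "f \<in> H_cm X \<longleftrightarrow> H_continuous X f \<and> (\<exists>\<phi>\<in>C_funs X. \<exists>\<psi>\<in>C_funs X. fun_le X \<phi> f \<and> fun_le X f \<psi>)"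
proof -
  have "set_of (f x) \<subseteq> range ereal"
    if "\<phi> \<in> C_funs X" "\<psi> \<in> C_funs X" "fun_le X \<phi> f" "fun_le X f \<psi>" "x \<in> topspace X" for \<phi> \<psi> x
  proof
    fix z assume z: "z \<in> set_of (f x)"
    obtain p q where "\<phi> = embed_real X p" "\<psi> = embed_real X q"
      using \<open>\<phi> \<in> C_funs X\<close> \<open>\<psi> \<in> C_funs X\<close> by (auto simp: C_funs_def)
    then have "ereal (p x) \<le> z" "z \<le> ereal (q x)"
      using z \<open>fun_le X \<phi> f\<close> \<open>fun_le X f \<psi>\<close> \<open>x \<in> topspace X\<close>
      by (auto simp: fun_le_embed_iff embed_fun_le_iff set_of_eq intro: order_trans)
    then show "z \<in> range ereal"
      by (cases z) auto
  qed
  then show ?thesis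
    by (auto simp: H_cm_def H_ft_def H_funs_def)
qed

lemma C_funs_subset_H_cm: "C_funs X \<subseteq> H_cm X"
proof
  fix f assume f: "f \<in> C_funs X"
  then obtain \<phi> where \<phi>: "continuous_map X euclideanreal \<phi>" "f = embed_real X \<phi>"
    by (auto simp: C_funs_def)
  have "lsc_env X (\<lambda>y. upper (f y)) x = lsc_env X (\<lambda>y. ereal (\<phi> y)) x"
    "usc_env X (\<lambda>y. lower (f y)) x = usc_env X (\<lambda>y. ereal (\<phi> y)) x" for x
    by (auto intro!: antisym lsc_env_mono usc_env_mono simp: \<phi> embed_real_def)
  then have "H_continuous X f"
    using \<phi> by (subst H_continuous_iff)
      (auto simp: interval_funs_def embed_real_def lsc_env_continuous usc_env_continuous)
  then show "f \<in> H_cm X"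
    using f fun_le_refl by (auto simp: H_cm_iff)
qed

text \<open>
  The bump function \<open>\<eta>\<close> interpolates between the given minorant \<open>\<phi>\<close>, away from \<open>x\<close>, and
  \<open>max \<phi> r\<close>, at \<open>x\<close>; the latter is a minorant on the open set \<open>U\<close> that carries \<open>\<eta>\<close>.
\<close>

lemma continuous_minorant:
  fixes k :: "'a \<Rightarrow> ereal"
  assumes X: "completely_regular_space X" and \<phi>: "continuous_map X euclideanreal \<phi>"
    and le: "\<And>y. y \<in> topspace X \<Longrightarrow> ereal (\<phi> y) \<le> k y"
    and U: "openin X U" "x \<in> U" "\<And>y. y \<in> U \<Longrightarrow> ereal r < k y"
  obtains \<psi> where "continuous_map X euclideanreal \<psi>"
    "\<And>y. y \<in> topspace X \<Longrightarrow> ereal (\<psi> y) \<le> k y" "r \<le> \<psi> x"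
proof -
  have "x \<in> topspace X" "U \<in> nbhds_of X x"
    using U(1,2) openin_subset by (fastforce simp: nbhds_of_def)+
  then obtain \<eta> where \<eta>: "continuous_map X (top_of_set {0..1::real}) \<eta>" "\<eta> x = 1"
    "\<And>y. y \<in> topspace X - U \<Longrightarrow> \<eta> y = 0"
    using X[unfolded completely_regular_space_nbhds] by metis
  then have c: "continuous_map X euclideanreal \<eta>" and b: "\<And>y. y \<in> topspace X \<Longrightarrow> \<eta> y \<in> {0..1}"
    by (auto simp: continuous_map_in_subtopology)
  let ?\<psi> = "\<lambda>y. \<phi> y + max 0 (r - \<phi> y) * \<eta> y"
  have "continuous_map X euclideanreal ?\<psi>"
    by (intro continuous_map_add continuous_map_real_mult continuous_map_real_max
        continuous_map_diff continuous_map_const[THEN iffD2] c \<phi>) auto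
  moreover have "ereal (?\<psi> y) \<le> k y" if y: "y \<in> topspace X" for y
  proof (cases "y \<in> U")
    case True
    have "max 0 (r - \<phi> y) * \<eta> y \<le> max 0 (r - \<phi> y)"
      using b[OF y] by (intro mult_left_le) auto
    then have "ereal (?\<psi> y) \<le> ereal (max (\<phi> y) r)"
      unfolding ereal_less_eq by (simp add: max_def split: if_splits)
    also have "\<dots> \<le> k y"
      using le[OF y] less_imp_le[OF U(3)[OF True]] by (simp add: max_def)
    finally show ?thesis .
  next
    case False
    then show ?thesis using le y \<eta>(3) by simp
  qed
  moreover have "r \<le> ?\<psi> x"
    using \<eta>(2) by simp
  ultimately show ?thesis by (rule that)
qed


section \<open>Order completeness\<close>

lemma partial_order_fun_order:
  assumes "F \<subseteq> interval_funs X"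
  shows "partial_order (fun_order X F)"
  using assms
  by unfold_locales
    (auto simp: fun_order_def fun_le_refl intro: fun_le_trans fun_le_antisym)

lemma least_Upper_fun_order_iff:
  assumes "A \<subseteq> F"
  shows "least (fun_order X F) s (Upper (fun_order X F) A) \<longleftrightarrow>
    s \<in> F \<and> (\<forall>f\<in>A. fun_le X f s) \<and> (\<forall>b\<in>F. (\<forall>f\<in>A. fun_le X f b) \<longrightarrow> fun_le X s b)"
  unfolding least_def Upper_def fun_order_def using assms by auto blast

lemma greatest_Lower_fun_order_iff:
  assumes "A \<subseteq> F"
  shows "greatest (fun_order X F) s (Lower (fun_order X F) A) \<longleftrightarrow>
    s \<in> F \<and> (\<forall>f\<in>A. fun_le X s f) \<and> (\<forall>b\<in>F. (\<forall>f\<in>A. fun_le X b f) \<longrightarrow> fun_le X b s)"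
  unfolding greatest_def Lower_def fun_order_def using assms by auto blast

text \<open>
  A pointwise supremum of the upper endpoints would in general not be upper semicontinuous, so the
  supremum is built from the lower endpoints alone. The pair \<open>[h, S h]\<close> need not be H-continuous;
  replacing \<open>h\<close> by \<open>I S h\<close> repairs this without changing the upper envelope, because
  \<open>h \<le> I S h \<le> S h\<close>. A continuous minorant comes from any member of \<open>A\<close>, a continuous majorant from
  the bound \<open>b\<close>.
\<close>

lemma H_cm_has_sup:
  assumes A: "A \<subseteq> H_cm X" "A \<noteq> {}" and b: "b \<in> H_cm X" "\<forall>f\<in>A. fun_le X f b"
  shows "\<exists>s\<in>H_cm X. (\<forall>f\<in>A. fun_le X f s) \<and>
    (\<forall>c\<in>H_cm X. (\<forall>f\<in>A. fun_le X f c) \<longrightarrow> fun_le X s c)"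
proof -
  define h where "h = (\<lambda>x. SUP f\<in>A. lower (f x))"
  define u where "u = usc_env X h"
  define l where "l = lsc_env X u"
  define s where "s = (\<lambda>x\<in>topspace X. Interval (l x, u x))"
  have HA: "H_continuous X f" if "f \<in> A" for f
    using A that by (auto simp: H_cm_iff)
  have lu: "l x \<le> u x" for x
    unfolding l_def by (rule lsc_env_le)
  then have s: "lower (s x) = l x" "upper (s x) = u x" if "x \<in> topspace X" for x
    using that lu by (simp_all add: s_def lower.rep_eq upper.rep_eq Interval_inverse)
  have lower_le_l: "lower (f x) \<le> l x" if f: "f \<in> A" and x: "x \<in> topspace X" for f x
  proof -
    have "lower (f y) \<le> h y" for y
      unfolding h_def using f by (rule SUP_upper)
    then have "lower (f y) \<le> u y" for y
      unfolding u_def using usc_env_ge by (rule order_trans)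
    then have "lsc_env X (\<lambda>y. lower (f y)) x \<le> l x"
      unfolding l_def by (intro lsc_env_mono)
    then show ?thesis
      using HA[OF f] x by (simp add: lsc_env_lower)
  qed
  have "usc_env X l x = u x" for x
  proof (rule antisym)
    have "usc_env X l x \<le> usc_env X u x"
      using lu by (rule usc_env_mono)
    then show "usc_env X l x \<le> u x"
      by (simp add: u_def usc_env_idem)
    show "u x \<le> usc_env X l x"
      unfolding u_def by (rule usc_env_mono) (auto simp: h_def intro: SUP_least lower_le_l)
  qed
  moreover have "lsc_env X (\<lambda>y. upper (s y)) x = lsc_env X u x"
    "usc_env X (\<lambda>y. lower (s y)) x = usc_env X l x" for x
    by (auto intro!: antisym lsc_env_mono usc_env_mono simp: s)
  moreover have "s \<in> interval_funs X"
    by (simp add: s_def interval_funs_def)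
  ultimately have Hs: "H_continuous X s"
    by (subst H_continuous_iff) (auto simp: s l_def)
  have ub: "fun_le X f s" if "f \<in> A" for f
    using HA[OF that] Hs by (rule fun_le_if_lower_le) (simp add: s lower_le_l that)
  have lub: "fun_le X s c" if c: "c \<in> H_cm X" "\<forall>f\<in>A. fun_le X f c" for c
  proof (rule fun_le_if_upper_le[OF Hs])
    show Hc: "H_continuous X c"
      using c by (simp add: H_cm_iff)
    fix x assume x: "x \<in> topspace X"
    have "u x \<le> usc_env X (\<lambda>y. lower (c y)) x"
      unfolding u_def using c(2)
      by (intro usc_env_mono) (auto simp: h_def fun_le_def interval_le_def intro: SUP_least)
    then show "upper (s x) \<le> upper (c x)"
      using Hc x by (simp add: s H_continuousD)
  qed
  obtain f where f: "f \<in> A" using A by blast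
  have "f \<in> H_cm X" using f A by blast
  then obtain \<phi> where "\<phi> \<in> C_funs X" "fun_le X \<phi> f"
    by (auto simp: H_cm_iff)
  moreover obtain \<psi> where "\<psi> \<in> C_funs X" "fun_le X b \<psi>"
    using b by (auto simp: H_cm_iff)
  ultimately have "s \<in> H_cm X"
    using Hs ub[OF f] lub[OF b] by (auto simp: H_cm_iff intro: fun_le_trans)
  then show ?thesis
    using ub lub by blast
qed

text \<open>The infimum is the supremum of all lower bounds; each member of \<open>A\<close> bounds these from above.\<close>

lemma H_cm_has_inf:
  assumes A: "A \<subseteq> H_cm X" "A \<noteq> {}" and b: "b \<in> H_cm X" "\<forall>f\<in>A. fun_le X b f"
  shows "\<exists>i\<in>H_cm X. (\<forall>f\<in>A. fun_le X i f) \<and>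
    (\<forall>c\<in>H_cm X. (\<forall>f\<in>A. fun_le X c f) \<longrightarrow> fun_le X c i)"
proof -
  let ?L = "{c \<in> H_cm X. \<forall>f\<in>A. fun_le X c f}"
  obtain a where "a \<in> A" using A by blast
  then have "\<exists>s\<in>H_cm X. (\<forall>f\<in>?L. fun_le X f s) \<and>
      (\<forall>c\<in>H_cm X. (\<forall>f\<in>?L. fun_le X f c) \<longrightarrow> fun_le X s c)"
    using A b by (intro H_cm_has_sup[where b = a]) auto
  then show ?thesis
    using A by blast
qed

lemma dedekind_complete_H_cm: "dedekind_complete (fun_order X (H_cm X))"
  unfolding dedekind_complete_def
proof (intro conjI allI impI; (elim conjE)?)
  show "partial_order (fun_order X (H_cm X))"
    by (rule partial_order_fun_order) (auto simp: H_cm_iff H_continuous_def)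
next
  fix A assume A: "A \<subseteq> carrier (fun_order X (H_cm X))" "A \<noteq> {}"
  then have A': "A \<subseteq> H_cm X" by (simp add: fun_order_def)
  {
    assume "Upper (fun_order X (H_cm X)) A \<noteq> {}"
    then obtain b where "b \<in> H_cm X" "\<forall>f\<in>A. fun_le X f b"
      using A' by (auto simp: Upper_def fun_order_def)
    then show "\<exists>s. least (fun_order X (H_cm X)) s (Upper (fun_order X (H_cm X)) A)"
      using H_cm_has_sup[OF A' A(2)] unfolding least_Upper_fun_order_iff[OF A'] by blast
  next
    assume "Lower (fun_order X (H_cm X)) A \<noteq> {}"
    then obtain b where "b \<in> H_cm X" "\<forall>f\<in>A. fun_le X b f"
      using A' by (auto simp: Lower_def fun_order_def)
    then show "\<exists>i. greatest (fun_order X (H_cm X)) i (Lower (fun_order X (H_cm X)) A)"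
      using H_cm_has_inf[OF A' A(2)] unfolding greatest_Lower_fun_order_iff[OF A'] by blast
  }
qed


section \<open>Density of the continuous functions\<close>

text \<open>
  It suffices to compare lower endpoints, and there \<open>continuous_minorant\<close> produces, for every point
  and every level below the lower endpoint of \<open>q\<close>, a continuous minorant that reaches this level.
\<close>

lemma fun_le_if_minorants_le:
  assumes X: "completely_regular_space X" and q: "q \<in> H_cm X" and b: "H_continuous X b"
    and le: "\<And>\<phi>. \<phi> \<in> C_funs X \<Longrightarrow> fun_le X \<phi> q \<Longrightarrow> fun_le X \<phi> b"
  shows "fun_le X q b"
proof (rule fun_le_if_lower_le[OF _ b])
  show Hq: "H_continuous X q"
    using q by (simp add: H_cm_iff)
  fix x assume x: "x \<in> topspace X"
  obtain \<phi> where \<phi>: "continuous_map X euclideanreal \<phi>" "fun_le X (embed_real X \<phi>) q"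
    using q by (auto simp: H_cm_iff C_funs_def)
  show "lower (q x) \<le> lower (b x)"
  proof (rule dense_le)
    fix r assume r: "r < lower (q x)"
    then obtain U where U: "openin X U" "x \<in> U" "\<forall>y\<in>U. r < lower (q y)"
      using lsc_env_lower[OF Hq x] less_lsc_envD[of r X "\<lambda>y. lower (q y)" x] by auto
    show "r \<le> lower (b x)"
    proof (cases r)
      case (real t)
      obtain \<psi> where \<psi>: "continuous_map X euclideanreal \<psi>"
        "\<And>y. y \<in> topspace X \<Longrightarrow> ereal (\<psi> y) \<le> lower (q y)" "t \<le> \<psi> x"
        using continuous_minorant[OF X \<phi>(1), of "\<lambda>y. lower (q y)" U x t] \<phi>(2) U
        by (auto simp: fun_le_embed_iff real)
      then have "fun_le X (embed_real X \<psi>) b"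
        by (intro le) (auto simp: C_funs_def fun_le_embed_iff)
      then have "ereal (\<psi> x) \<le> lower (b x)"
        using x by (simp add: fun_le_embed_iff)
      then show ?thesis
        using \<psi>(3) real by (metis ereal_less_eq(3) order_trans)
    qed (use r in auto)
  qed
qed

text \<open>
  The order dual, obtained by applying \<open>continuous_minorant\<close> to the negated upper endpoint of \<open>q\<close>.
\<close>

lemma fun_le_if_le_majorants:
  assumes X: "completely_regular_space X" and q: "q \<in> H_cm X" and b: "H_continuous X b"
    and le: "\<And>\<phi>. \<phi> \<in> C_funs X \<Longrightarrow> fun_le X q \<phi> \<Longrightarrow> fun_le X b \<phi>"
  shows "fun_le X b q"
proof (rule fun_le_if_upper_le[OF b])
  show Hq: "H_continuous X q"
    using q by (simp add: H_cm_iff)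
  fix x assume x: "x \<in> topspace X"
  obtain \<phi> where \<phi>: "continuous_map X euclideanreal \<phi>" "fun_le X q (embed_real X \<phi>)"
    using q by (auto simp: H_cm_iff C_funs_def)
  show "upper (b x) \<le> upper (q x)"
  proof (rule dense_ge)
    fix r assume r: "upper (q x) < r"
    then obtain U where U: "openin X U" "x \<in> U" "\<forall>y\<in>U. upper (q y) < r"
      using usc_env_upper[OF Hq x] usc_env_lessD[of X "\<lambda>y. upper (q y)" x r] by auto
    show "upper (b x) \<le> r"
    proof (cases r)
      case (real t)
      have "continuous_map X euclideanreal (\<lambda>y. - \<phi> y)"
        using \<phi>(1) by (rule continuous_map_minus)
      moreover have "ereal (- \<phi> y) \<le> - upper (q y)" if "y \<in> topspace X" for y
        using \<phi>(2) that by (simp add: embed_fun_le_iff flip: uminus_ereal.simps(1))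
      moreover have "ereal (- t) < - upper (q y)" if "y \<in> U" for y
        using U(3) that by (simp add: real flip: uminus_ereal.simps(1))
      ultimately obtain \<psi> where \<psi>: "continuous_map X euclideanreal \<psi>"
        "\<And>y. y \<in> topspace X \<Longrightarrow> ereal (\<psi> y) \<le> - upper (q y)" "- t \<le> \<psi> x"
        using continuous_minorant[OF X, of "\<lambda>y. - \<phi> y" "\<lambda>y. - upper (q y)" U x "- t"] U(1,2)
        by metis
      have "upper (q y) \<le> ereal (- \<psi> y)" if "y \<in> topspace X" for y
        using \<psi>(2)[OF that] by (metis ereal_minus_le_minus ereal_uminus_uminus uminus_ereal.simps(1))
      then have "fun_le X b (embed_real X (\<lambda>y. - \<psi> y))"
        using \<psi>(1) by (intro le) (auto simp: C_funs_def embed_fun_le_iff intro!: continuous_map_minus)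
      then have "upper (b x) \<le> ereal (- \<psi> x)"
        using x by (simp add: embed_fun_le_iff)
      also have "\<dots> \<le> r"
        using \<psi>(3) real by simp
      finally show ?thesis .
    qed (use r in auto)
  qed
qed

theorem mainTheorem4:
  fixes X :: "'a topology"
  assumes "completely_regular_space X"
  shows "is_dedekind_completion (fun_order X (H_cm X)) (C_funs X) \<and> H_cm X \<subseteq> H_ft X"
proof -
  let ?Q = "fun_order X (H_cm X)"
  have "least ?Q q (Upper ?Q {\<phi> \<in> C_funs X. fun_le X \<phi> q})" if q: "q \<in> H_cm X" for q
    using q C_funs_subset_H_cm[of X] fun_le_if_minorants_le[OF assms q]
    by (subst least_Upper_fun_order_iff) (auto simp: H_cm_iff)
  moreover have "greatest ?Q q (Lower ?Q {\<phi> \<in> C_funs X. fun_le X q \<phi>})" if q: "q \<in> H_cm X" for q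
    using q C_funs_subset_H_cm[of X] fun_le_if_le_majorants[OF assms q]
    by (subst greatest_Lower_fun_order_iff) (auto simp: H_cm_iff)
  moreover have "carrier ?Q = H_cm X"
    by (simp add: fun_order_def)
  ultimately have "is_dedekind_completion ?Q (C_funs X)"
    using C_funs_subset_H_cm[of X] dedekind_complete_H_cm[of X]
    unfolding is_dedekind_completion_def by (metis (no_types, lifting) mem_Collect_eq subsetI)
  then show ?thesis
    by (auto simp: H_cm_def)
qed

end
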